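(* For any finite set $X$, the language $\mathrm{UConjGeo}(\mathrm{FIM}_X)$ is a context-free language (over the alphabet $\tilde X=X\cup X^{-1}$), where $\mathrm{FIM}_X$ is the free inverse monoid on $X$.
   Context: $\tilde X = X\cup X^{-1}$, where $X^{-1}=\{x^{-1}: x\in X\}$ is a disjoint copy of $X$ consisting of formal inverses; $\tilde X^*$ is the free monoid on $\tilde X$, $\ell(w)$ is the length of a word $w\in\tilde X^*$, and $\pi\colon \tilde X^*\to \mathrm{FIM}_X$ is the canonical surjective homomorphism. A word $w\in\tilde X^*$ is a geodesic if $\ell(w)\le \ell(u)$ for every $u\in \tilde X^*$ with $u\pi=w\pi$; $\mathrm{Geo}(\mathrm{FIM}_X)$ is the set of all geodesics. Two elements $a,b$ of an inverse monoid $S$ are conjugate ($i$-conjugate) if there is $g\in S$ with $g^{-1}ag=b$ and $gbg^{-1}=a$. This is an equivalence relation; $[a]$ denotes the conjugacy class of $a$, called trivial if $[a]=\{a\}$. $\mathrm{UConj}$ is the equivalence relation on $\mathrm{FIM}_X$ defined by: $(a,b)\in\mathrm{UConj}$ iff $a=b$, or both $[a]$ and $[b]$ are nontrivial. Then $\mathrm{UConjGeo}(\mathrm{FIM}_X)=\{w\in\mathrm{Geo}(\mathrm{FIM}_X): \ell(w)\le\ell(u)\text{ for all }u\in\mathrm{Geo}(\mathrm{FIM}_X)\text{ with }(w\pi,u\pi)\in\mathrm{UConj}\}$. *)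

theory Defs
  imports "HOL-Algebra.Group"
begin

section \<open>Inverse monoids and conjugacy\<close>

locale inverse_monoid = monoid S for S (structure) +
  assumes ex1_inverse:
    "a \<in> carrier S \<Longrightarrow> \<exists>!b. b \<in> carrier S \<and> a \<otimes> b \<otimes> a = a \<and> b \<otimes> a \<otimes> b = b"

text \<open>The inverse in the sense of inverse semigroups; it is not the group inverse \<open>m_inv\<close> of
  the library, since \<open>a \<otimes> b\<close> need not be \<open>\<one>\<close>.\<close>

definition inverse_of :: "('a, 'b) monoid_scheme \<Rightarrow> 'a \<Rightarrow> 'a" where
  "inverse_of S a =
     (THE b. b \<in> carrier S \<and> a \<otimes>\<^bsub>S\<^esub> b \<otimes>\<^bsub>S\<^esub> a = a \<and> b \<otimes>\<^bsub>S\<^esub> a \<otimes>\<^bsub>S\<^esub> b = b)"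

definition i_conjugate :: "('a, 'b) monoid_scheme \<Rightarrow> 'a \<Rightarrow> 'a \<Rightarrow> bool" where
  "i_conjugate S a b \<longleftrightarrow>
     (\<exists>g \<in> carrier S. inverse_of S g \<otimes>\<^bsub>S\<^esub> a \<otimes>\<^bsub>S\<^esub> g = b \<and> g \<otimes>\<^bsub>S\<^esub> b \<otimes>\<^bsub>S\<^esub> inverse_of S g = a)"

definition conj_class :: "('a, 'b) monoid_scheme \<Rightarrow> 'a \<Rightarrow> 'a set" where
  "conj_class S a = {b \<in> carrier S. i_conjugate S a b}"

definition UConj :: "('a, 'b) monoid_scheme \<Rightarrow> ('a \<times> 'a) set" where
  "UConj S = {(a, b) \<in> carrier S \<times> carrier S.
     a = b \<or> (conj_class S a \<noteq> {a} \<and> conj_class S b \<noteq> {b})}"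

section \<open>The free inverse monoid\<close>

datatype 'a letter = Gen 'a | Inv 'a

type_synonym 'a word = "'a letter list"

definition letters :: "'a set \<Rightarrow> 'a letter set" where
  "letters X = Gen ` X \<union> Inv ` X"

fun letter_inv :: "'a letter \<Rightarrow> 'a letter" where
  "letter_inv (Gen x) = Inv x"
| "letter_inv (Inv x) = Gen x"

definition word_inv :: "'a word \<Rightarrow> 'a word" where
  "word_inv w = rev (map letter_inv w)"

text \<open>The Vagner congruence: the least congruence on the free monoid \<open>lists (letters X)\<close>
  that contains all pairs \<open>(u u\<inverse> u, u)\<close> and \<open>(u u\<inverse> v v\<inverse>, v v\<inverse> u u\<inverse>)\<close>.\<close>

inductive_set vagner :: "'a set \<Rightarrow> ('a word \<times> 'a word) set" for X :: "'a set" where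
  regular: "u \<in> lists (letters X) \<Longrightarrow> (u @ word_inv u @ u, u) \<in> vagner X"
| commute: "u \<in> lists (letters X) \<Longrightarrow> v \<in> lists (letters X) \<Longrightarrow>
    (u @ word_inv u @ v @ word_inv v, v @ word_inv v @ u @ word_inv u) \<in> vagner X"
| refl: "u \<in> lists (letters X) \<Longrightarrow> (u, u) \<in> vagner X"
| sym: "(u, v) \<in> vagner X \<Longrightarrow> (v, u) \<in> vagner X"
| trans: "(u, v) \<in> vagner X \<Longrightarrow> (v, w) \<in> vagner X \<Longrightarrow> (u, w) \<in> vagner X"
| mult: "(u, u') \<in> vagner X \<Longrightarrow> (v, v') \<in> vagner X \<Longrightarrow> (u @ v, u' @ v') \<in> vagner X"

definition FIM :: "'a set \<Rightarrow> 'a word set monoid" where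
  "FIM X = \<lparr>carrier = lists (letters X) // vagner X,
            mult = (\<lambda>A B. \<Union>u \<in> A. \<Union>v \<in> B. vagner X `` {u @ v}),
            one = vagner X `` {[]}\<rparr>"

definition proj :: "'a set \<Rightarrow> 'a word \<Rightarrow> 'a word set" where
  "proj X w = vagner X `` {w}"

section \<open>The language \<open>UConjGeo\<close>\<close>

definition Geo :: "'a set \<Rightarrow> 'a word set" where
  "Geo X = {w \<in> lists (letters X).
     \<forall>u \<in> lists (letters X). proj X u = proj X w \<longrightarrow> length w \<le> length u}"

definition UConjGeo :: "'a set \<Rightarrow> 'a word set" where
  "UConjGeo X = {w \<in> Geo X.
     \<forall>u \<in> Geo X. (proj X w, proj X u) \<in> UConj (FIM X) \<longrightarrow> length w \<le> length u}"

section \<open>Context-free languages\<close>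

datatype ('n, 't) symbol = NT 'n | Tm 't

type_synonym ('n, 't) production = "'n \<times> ('n, 't) symbol list"

inductive derives1 :: "('n, 't) production set \<Rightarrow>
    ('n, 't) symbol list \<Rightarrow> ('n, 't) symbol list \<Rightarrow> bool" for P where
  "(A, \<gamma>) \<in> P \<Longrightarrow> derives1 P (\<alpha> @ [NT A] @ \<beta>) (\<alpha> @ \<gamma> @ \<beta>)"

definition generated :: "('n, 't) production set \<Rightarrow> 'n \<Rightarrow> 't list set" where
  "generated P S = {w. (derives1 P)\<^sup>*\<^sup>* [NT S] (map Tm w)}"

text \<open>A grammar consists of finite sets of nonterminals \<open>N\<close> and of productions \<open>P\<close>, and of a
  start symbol \<open>S\<close>. As \<open>N\<close> is finite, taking nonterminals from \<open>nat\<close> loses no generality.\<close>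

definition context_free :: "'t set \<Rightarrow> 't list set \<Rightarrow> bool" where
  "context_free \<Sigma> L \<longleftrightarrow> finite \<Sigma> \<and>
     (\<exists>(N :: nat set) P S. finite N \<and> finite P \<and> S \<in> N \<and>
        P \<subseteq> N \<times> lists (NT ` N \<union> Tm ` \<Sigma>) \<and> L = generated P S)"

section \<open>\<open>FIM X\<close> is an inverse monoid\<close>

lemma (in monoid) inverse_monoid_of_involution:
  assumes cl: "\<And>a. a \<in> carrier G \<Longrightarrow> s a \<in> carrier G"
    and inv: "\<And>a. a \<in> carrier G \<Longrightarrow> s (s a) = a"
    and anti: "\<And>a b. a \<in> carrier G \<Longrightarrow> b \<in> carrier G \<Longrightarrow> s (a \<otimes> b) = s b \<otimes> s a"
    and reg: "\<And>a. a \<in> carrier G \<Longrightarrow> a \<otimes> s a \<otimes> a = a"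
    and comm: "\<And>a b. a \<in> carrier G \<Longrightarrow> b \<in> carrier G \<Longrightarrow>
      (a \<otimes> s a) \<otimes> (b \<otimes> s b) = (b \<otimes> s b) \<otimes> (a \<otimes> s a)"
  shows "inverse_monoid G" "a \<in> carrier G \<Longrightarrow> inverse_of G a = s a"
proof -
  have reg': "s a \<otimes> a \<otimes> s a = s a" if "a \<in> carrier G" for a
    using reg[of "s a"] that by (simp add: cl inv)
  have proj_form: "e = e \<otimes> s e" if e: "e \<in> carrier G" "e \<otimes> e = e" for e
  proof -
    have ss: "s e \<otimes> s e = s e" using anti[of e e] e by simp
    have "e = e \<otimes> (s e \<otimes> s e) \<otimes> e" using reg[of e] e ss by simp
    also have "\<dots> = (e \<otimes> s e) \<otimes> (s e \<otimes> e)" using e by (simp add: m_assoc cl)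
    also have "\<dots> = (s e \<otimes> e) \<otimes> (e \<otimes> s e)" using comm[of e "s e"] e by (simp add: inv cl)
    also have "\<dots> = s e \<otimes> (e \<otimes> e) \<otimes> s e" using e(1) by (simp add: m_assoc cl)
    also have "\<dots> = s e" using reg' e by simp
    finally show ?thesis using e by simp
  qed
  have idem_comm: "e \<otimes> f = f \<otimes> e"
    if "e \<in> carrier G" "e \<otimes> e = e" "f \<in> carrier G" "f \<otimes> f = f" for e f
    using comm[of e f] proj_form that by metis
  have uniq: "b = c" if abc: "a \<in> carrier G" "b \<in> carrier G" "c \<in> carrier G"
    and b: "a \<otimes> b \<otimes> a = a" "b \<otimes> a \<otimes> b = b"
    and c: "a \<otimes> c \<otimes> a = a" "c \<otimes> a \<otimes> c = c" for a b c
  proof -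
    have i: "(a \<otimes> b) \<otimes> (a \<otimes> b) = a \<otimes> b" "(b \<otimes> a) \<otimes> (b \<otimes> a) = b \<otimes> a"
      "(a \<otimes> c) \<otimes> (a \<otimes> c) = a \<otimes> c" "(c \<otimes> a) \<otimes> (c \<otimes> a) = c \<otimes> a"
      using abc b c by (metis m_assoc m_closed)+
    have "b = b \<otimes> (a \<otimes> c \<otimes> a) \<otimes> b" using b c by simp
    also have "\<dots> = b \<otimes> ((a \<otimes> c) \<otimes> (a \<otimes> b))" using abc by (simp add: m_assoc)
    also have "\<dots> = b \<otimes> ((a \<otimes> b) \<otimes> (a \<otimes> c))"
      using idem_comm[of "a \<otimes> c" "a \<otimes> b"] i abc by simp
    also have "\<dots> = b \<otimes> a \<otimes> b \<otimes> a \<otimes> c" using abc by (simp add: m_assoc)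
    also have "\<dots> = b \<otimes> a \<otimes> c" using b by simp
    finally have 1: "b = b \<otimes> a \<otimes> c" .
    have "c = c \<otimes> (a \<otimes> b \<otimes> a) \<otimes> c" using b c by simp
    also have "\<dots> = ((c \<otimes> a) \<otimes> (b \<otimes> a)) \<otimes> c" using abc by (simp add: m_assoc)
    also have "\<dots> = ((b \<otimes> a) \<otimes> (c \<otimes> a)) \<otimes> c"
      using idem_comm[of "c \<otimes> a" "b \<otimes> a"] i abc by simp
    also have "\<dots> = b \<otimes> a \<otimes> (c \<otimes> a \<otimes> c)" using abc by (simp add: m_assoc)
    also have "\<dots> = b \<otimes> a \<otimes> c" using c by simp
    finally show ?thesis using 1 by simp
  qed
  have ex: "s a \<in> carrier G \<and> a \<otimes> s a \<otimes> a = a \<and> s a \<otimes> a \<otimes> s a = s a"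
    if "a \<in> carrier G" for a using that cl reg reg' by blast
  show "inverse_monoid G"
    by unfold_locales (metis ex uniq)
  show "inverse_of G a = s a" if "a \<in> carrier G"
    unfolding inverse_of_def using ex uniq that by (intro the_equality) blast+
qed

lemma letter_inv_in [simp]: "letter_inv x \<in> letters X \<longleftrightarrow> x \<in> letters X"
  by (cases x) (auto simp: letters_def)

lemma letter_inv_invol [simp]: "letter_inv (letter_inv x) = x"
  by (cases x) auto

lemma word_inv_invol [simp]: "word_inv (word_inv w) = w"
  by (simp add: word_inv_def rev_map comp_def)

lemma word_inv_append [simp]: "word_inv (u @ v) = word_inv v @ word_inv u"
  by (simp add: word_inv_def)

lemma word_inv_lists [simp]: "w \<in> lists (letters X) \<Longrightarrow> word_inv w \<in> lists (letters X)"
  by (auto simp: word_inv_def in_lists_conv_set)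

lemma vagner_lists: "(u, v) \<in> vagner X \<Longrightarrow> u \<in> lists (letters X) \<and> v \<in> lists (letters X)"
  by (induction rule: vagner.induct) auto

lemma vagner_equiv: "equiv (lists (letters X)) (vagner X)"
  by (auto intro!: equivI refl_onI symI transI dest: vagner_lists intro: vagner.intros)

lemma vagner_word_inv: "(u, v) \<in> vagner X \<Longrightarrow> (word_inv u, word_inv v) \<in> vagner X"
proof (induction rule: vagner.induct)
  case (regular u)
  then show ?case using vagner.regular[of "word_inv u" X] by simp
next
  case (commute u v)
  then show ?case using vagner.commute[of v X u] by simp
qed (use word_inv_lists in \<open>auto intro: vagner.intros simp del: in_lists_conv_set\<close>)

lemma proj_eq_iff:
  "u \<in> lists (letters X) \<Longrightarrow> v \<in> lists (letters X) \<Longrightarrow> proj X u = proj X v \<longleftrightarrow> (u, v) \<in> vagner X"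
  unfolding proj_def by (rule eq_equiv_class_iff[OF vagner_equiv])

lemma carrier_FIM: "carrier (FIM X) = proj X ` lists (letters X)"
  by (auto simp: FIM_def proj_def quotient_def)

lemma one_FIM: "\<one>\<^bsub>FIM X\<^esub> = proj X []"
  by (simp add: FIM_def proj_def)

lemma proj_mult:
  assumes "u \<in> lists (letters X)" "v \<in> lists (letters X)"
  shows "proj X u \<otimes>\<^bsub>FIM X\<^esub> proj X v = proj X (u @ v)"
proof -
  have "congruent2 (vagner X) (vagner X) (\<lambda>u v. vagner X `` {u @ v})"
    by (intro congruent2I' equiv_class_eq[OF vagner_equiv] vagner.mult)
  from UN_equiv_class2[OF vagner_equiv vagner_equiv this assms] show ?thesis
    by (simp add: FIM_def proj_def)
qed

lemma image_word_inv_proj: "word_inv ` proj X w = proj X (word_inv w)"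
proof (intro Set.set_eqI iffI)
  fix x assume "x \<in> proj X (word_inv w)"
  then have "word_inv x \<in> proj X w"
    using vagner_word_inv[of "word_inv w" x X] by (simp add: proj_def)
  then show "x \<in> word_inv ` proj X w" by (metis image_eqI word_inv_invol)
qed (auto simp: proj_def intro: vagner_word_inv)

lemma monoid_FIM: "monoid (FIM X)"
  by unfold_locales
    (unfold carrier_FIM one_FIM,
      ((elim imageE)?, simp add: proj_mult del: in_lists_conv_set)+)

theorem inverse_monoid_FIM: "inverse_monoid (FIM X)"
  and inverse_of_proj:
    "w \<in> lists (letters X) \<Longrightarrow> inverse_of (FIM X) (proj X w) = proj X (word_inv w)"
proof -
  interpret monoid "FIM X" by (rule monoid_FIM)
  let ?L = "lists (letters X)" and ?s = "\<lambda>a. word_inv ` a" and ?C = "carrier (FIM X)"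
  note [simp del] = in_lists_conv_set
  have cl: "?s a \<in> ?C" if "a \<in> ?C" for a
    using that
    by (auto simp only: carrier_FIM image_word_inv_proj intro!: imageI word_inv_lists)
  have inv: "?s (?s a) = a" for a
    by (simp add: image_image)
  have anti: "?s (a \<otimes>\<^bsub>FIM X\<^esub> b) = ?s b \<otimes>\<^bsub>FIM X\<^esub> ?s a" if "a \<in> ?C" "b \<in> ?C" for a b
    using that unfolding carrier_FIM
    by (elim imageE) (simp add: image_word_inv_proj proj_mult)
  have reg: "a \<otimes>\<^bsub>FIM X\<^esub> ?s a \<otimes>\<^bsub>FIM X\<^esub> a = a" if a: "a \<in> ?C" for a
  proof -
    obtain u where u: "u \<in> ?L" "a = proj X u" using a by (auto simp: carrier_FIM)
    then show ?thesis
      using vagner.regular[of u X] by (simp add: image_word_inv_proj proj_mult proj_eq_iff)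
  qed
  have comm: "(a \<otimes>\<^bsub>FIM X\<^esub> ?s a) \<otimes>\<^bsub>FIM X\<^esub> (b \<otimes>\<^bsub>FIM X\<^esub> ?s b) =
      (b \<otimes>\<^bsub>FIM X\<^esub> ?s b) \<otimes>\<^bsub>FIM X\<^esub> (a \<otimes>\<^bsub>FIM X\<^esub> ?s a)" if ab: "a \<in> ?C" "b \<in> ?C" for a b
  proof -
    obtain u v where uv: "u \<in> ?L" "a = proj X u" "v \<in> ?L" "b = proj X v"
      using ab by (auto simp: carrier_FIM)
    then show ?thesis
      using vagner.commute[of u X v] by (simp add: image_word_inv_proj proj_mult proj_eq_iff)
  qed
  show "inverse_monoid (FIM X)"
    by (rule inverse_monoid_of_involution(1)[of ?s, OF cl inv anti reg comm])
  show "inverse_of (FIM X) (proj X w) = proj X (word_inv w)" if "w \<in> ?L"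
    using inverse_monoid_of_involution(2)[of ?s, OF cl inv anti reg comm, of "proj X w"] that
    by (simp add: carrier_FIM image_word_inv_proj)
qed

end

(* By Munn's theorem an element of FIM X is a finite subtree T of the Cayley tree of the free
   group together with an end vertex g. A word is a geodesic iff its walk never steps away from
   the root into a vertex that it has visited before, and the class of (T, g) is trivial iff no
   letter labels edges of T both at the root and at g. All elements of UConjGeo X with nontrivial
   class have the same length, so there are finitely many. The other elements are generated by a
   grammar that keeps track of the edges used at the current vertex and, once the walk has left
   the root for good, of those used at the root. *)
theory Submission
  imports Defs
begin

section \<open>Walks in the Cayley tree\<close>

text \<open>A geodesic never re-enters a subtree that it has left, so the shape of that subtree can
  be forgotten on returning to the parent: for each vertex only the finite set of used edges
  matters, and a new vertex starts with just its parent edge. The sets of the ancestors of the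
  current vertex are unbounded in number and form a stack, which is what calls for a context-free
  grammar. The obstacle is the triviality test, which compares the two ends of that stack. Each
  letter into a new vertex is therefore guessed to open a detour that will return or to lie on the
  final path.\<close>

text \<open>A vertex of the Cayley tree of the free group is a reduced word written backwards, so that
  the head of the list is the edge leading to its parent.\<close>

fun push :: "'a letter \<Rightarrow> 'a word \<Rightarrow> 'a word" where
  "push x [] = [x]"
| "push x (y # h) = (if y = letter_inv x then h else x # y # h)"

fun reduced :: "'a word \<Rightarrow> bool" where
  "reduced [] = True"
| "reduced (x # h) = (push x h = x # h \<and> reduced h)"

abbreviation walk :: "'a word \<Rightarrow> 'a word \<Rightarrow> 'a word" where
  "walk w h \<equiv> fold push w h"

fun visited :: "'a word \<Rightarrow> 'a word \<Rightarrow> 'a word set" where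
  "visited h [] = {h}"
| "visited h (x # w) = insert h (visited (push x h) w)"

lemma letter_inv_eq_iff: "letter_inv x = y \<longleftrightarrow> x = letter_inv y"
  by auto

lemma letter_inv_neq [simp]: "letter_inv x \<noteq> x"
  by (cases x) auto

lemma push_cases:
  obtains "push x h = x # h" | "h = letter_inv x # push x h"
proof (cases h)
  case (Cons y t)
  then show ?thesis using that by (cases "y = letter_inv x") auto
qed (use that in auto)

lemma reduced_push: "reduced h \<Longrightarrow> reduced (push x h)"
  by (cases h) auto

lemma reduced_walk: "reduced h \<Longrightarrow> reduced (walk w h)"
  by (induction w arbitrary: h) (auto simp: reduced_push)

text \<open>Letters act invertibly on reduced words only: on \<open>letter_inv x # x # t\<close>
  both pushes cancel and the result is \<open>t\<close>.\<close>

lemma push_inv: "reduced h \<Longrightarrow> push (letter_inv x) (push x h) = h"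
  by (cases h) auto

lemma visited_self [simp]: "h \<in> visited h w"
  by (cases w) auto

lemma walk_in_visited [simp]: "walk w h \<in> visited h w"
  by (induction w arbitrary: h) auto

lemma finite_visited [simp]: "finite (visited h w)"
  by (induction w arbitrary: h) auto

lemma visited_append: "visited h (u @ v) = visited h u \<union> visited (walk u h) v"
  by (induction u arbitrary: h) (auto simp: insert_absorb)

lemma word_inv_simps [simp]:
  "word_inv [] = []" "word_inv (x # w) = word_inv w @ [letter_inv x]"
  by (simp_all add: word_inv_def)

lemma walk_word_inv: "reduced h \<Longrightarrow> walk (word_inv u) (walk u h) = h"
  by (induction u arbitrary: h) (auto simp: reduced_push push_inv)

lemma visited_word_inv: "reduced h \<Longrightarrow> visited (walk u h) (word_inv u) = visited h u"
  by (induction u arbitrary: h)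
    (auto simp: visited_append walk_word_inv reduced_push push_inv)

lemma push_lists: "x \<in> A \<Longrightarrow> h \<in> lists A \<Longrightarrow> push x h \<in> lists A"
  by (cases h) auto

lemma visited_lists: "h \<in> lists A \<Longrightarrow> w \<in> lists A \<Longrightarrow> visited h w \<subseteq> lists A"
proof (induction w arbitrary: h)
  case (Cons x w)
  then show ?case using push_lists[of x A h] by auto
qed auto

section \<open>Munn's theorem\<close>

text \<open>The easy half of Munn's theorem, checked on the generating pairs: the path of
  \<open>word_inv u\<close> retraces that of \<open>u\<close>. The start vertex varies because the
  second factor of a product starts where the first one ends.\<close>

lemma vagner_walk_visited:
  "(u, v) \<in> vagner X \<Longrightarrow> reduced h \<Longrightarrow> walk u h = walk v h \<and> visited h u = visited h v"
proof (induction arbitrary: h rule: vagner.induct)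
  case (mult u u' v v')
  then show ?case by (simp add: visited_append reduced_walk)
qed (auto simp: visited_append walk_word_inv visited_word_inv reduced_walk)

lemma vagner_left:
  "(u, v) \<in> vagner X \<Longrightarrow> a \<in> lists (letters X) \<Longrightarrow> (a @ u, a @ v) \<in> vagner X"
  by (intro vagner.mult vagner.refl)

lemma vagner_right:
  "(u, v) \<in> vagner X \<Longrightarrow> b \<in> lists (letters X) \<Longrightarrow> (u @ b, v @ b) \<in> vagner X"
  by (intro vagner.mult vagner.refl)

text \<open>The path from the root to \<open>h\<close> and back, an idempotent of the monoid;
  \<open>rev\<close> undoes the backward storage of vertices.\<close>

definition vertex_idem :: "'a word \<Rightarrow> 'a word" where
  "vertex_idem h = rev h @ word_inv (rev h)"

definition idems :: "'a word list \<Rightarrow> 'a word" where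
  "idems hs = concat (map vertex_idem hs)"

text \<open>A list in place of the set \<open>visited\<close>, as the product \<open>idems\<close>
  needs an order; by \<open>idems_cong\<close> neither order nor repetition matters up to the Vagner
  congruence.\<close>

fun trace :: "'a word \<Rightarrow> 'a word \<Rightarrow> 'a word list" where
  "trace h [] = [h]"
| "trace h (x # w) = h # trace (push x h) w"

lemma set_trace: "set (trace h w) = visited h w"
  by (induction w arbitrary: h) auto

lemma trace_snoc: "trace h (w @ [x]) = trace h w @ [push x (walk w h)]"
  by (induction w arbitrary: h) auto

lemma idems_simps [simp]:
  "idems [] = []" "idems (h # hs) = vertex_idem h @ idems hs"
  "idems (hs @ hs') = idems hs @ idems hs'"
  by (simp_all add: idems_def)

lemma vertex_idem_lists [simp]:
  "h \<in> lists (letters X) \<Longrightarrow> vertex_idem h \<in> lists (letters X)"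
  using word_inv_lists[of "rev h" X] by (simp add: vertex_idem_def in_lists_conv_set ball_Un)

lemma idems_lists: "set hs \<subseteq> lists (letters X) \<Longrightarrow> idems hs \<in> lists (letters X)"
proof (induction hs)
  case (Cons h hs)
  then show ?case
    using vertex_idem_lists[of h X] by (simp del: vertex_idem_lists)
qed auto

context
  fixes X :: "'a set"
begin

abbreviation vagner_rel (infix "\<approx>" 50) where "u \<approx> v \<equiv> (u, v) \<in> vagner X"

abbreviation "LX \<equiv> lists (letters X)"

declare vagner.trans [trans]

lemma vertex_idem_commute:
  "h \<in> LX \<Longrightarrow> k \<in> LX \<Longrightarrow> vertex_idem h @ vertex_idem k \<approx> vertex_idem k @ vertex_idem h"
  using vagner.commute[of "rev h" X "rev k"]
  by (simp add: vertex_idem_def in_lists_conv_set)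

lemma vertex_idem_idem: "h \<in> LX \<Longrightarrow> vertex_idem h @ vertex_idem h \<approx> vertex_idem h"
  using vagner.mult[OF vagner.regular[of "rev h" X] vagner.refl[of "word_inv (rev h)" X]]
    word_inv_lists[of "rev h" X]
  by (simp add: vertex_idem_def in_lists_conv_set)

lemma vertex_idem_idems_commute:
  "h \<in> LX \<Longrightarrow> set hs \<subseteq> LX \<Longrightarrow> vertex_idem h @ idems hs \<approx> idems hs @ vertex_idem h"
proof (induction hs)
  case (Cons k hs)
  have "vertex_idem h @ vertex_idem k @ idems hs \<approx> vertex_idem k @ vertex_idem h @ idems hs"
    using vagner.mult[OF vertex_idem_commute[of h k] vagner.refl[of "idems hs"]] Cons.prems
    by (simp add: idems_lists)
  also have "vertex_idem k @ vertex_idem h @ idems hs \<approx> vertex_idem k @ idems hs @ vertex_idem h"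
    using Cons by (intro vagner_left) simp_all
  finally show ?case by simp
qed (simp add: vagner.refl)

lemma idems_commute:
  "set hs \<subseteq> LX \<Longrightarrow> set ks \<subseteq> LX \<Longrightarrow> idems hs @ idems ks \<approx> idems ks @ idems hs"
proof (induction hs)
  case (Cons h hs)
  have "vertex_idem h @ idems hs @ idems ks \<approx> vertex_idem h @ idems ks @ idems hs"
    using Cons by (intro vagner_left) simp_all
  also have "vertex_idem h @ idems ks @ idems hs \<approx> idems ks @ vertex_idem h @ idems hs"
    using vagner.mult[OF vertex_idem_idems_commute[of h ks] vagner.refl[of "idems hs"]] Cons.prems
    by (simp add: idems_lists)
  finally show ?case by simp
qed (simp add: vagner.refl idems_lists)

lemma idems_absorb:
  "h \<in> set hs \<Longrightarrow> set hs \<subseteq> LX \<Longrightarrow> vertex_idem h @ idems hs \<approx> idems hs"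
proof (induction hs)
  case (Cons k hs)
  show ?case
  proof (cases "h = k")
    case True
    then show ?thesis
      using vagner.mult[OF vertex_idem_idem[of k] vagner.refl[of "idems hs"]] Cons.prems
      by (simp add: idems_lists)
  next
    case False
    have "vertex_idem h @ vertex_idem k @ idems hs \<approx> vertex_idem k @ vertex_idem h @ idems hs"
      using vagner.mult[OF vertex_idem_commute[of h k] vagner.refl[of "idems hs"]] Cons.prems
      by (auto simp add: idems_lists)
    also have "vertex_idem k @ vertex_idem h @ idems hs \<approx> vertex_idem k @ idems hs"
      using Cons False by (intro vagner_left) auto
    finally show ?thesis by simp
  qed
qed simp

lemma idems_absorb_set:
  "set ks \<subseteq> set hs \<Longrightarrow> set hs \<subseteq> LX \<Longrightarrow> idems ks @ idems hs \<approx> idems hs"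
proof (induction ks)
  case (Cons k ks)
  have "k \<in> LX" using Cons.prems by (intro subsetD[OF Cons.prems(2)]) simp
  then have "vertex_idem k @ idems ks @ idems hs \<approx> vertex_idem k @ idems hs"
    using Cons by (intro vagner_left) simp_all
  also have "vertex_idem k @ idems hs \<approx> idems hs"
    using Cons.prems by (intro idems_absorb) auto
  finally show ?case by simp
qed (simp add: vagner.refl idems_lists)

text \<open>The factors are commuting idempotents, so each of the two products absorbs the
  other.\<close>

lemma idems_cong:
  assumes "set hs = set ks" "set hs \<subseteq> LX"
  shows "idems hs \<approx> idems ks"
proof -
  have "idems hs \<approx> idems ks @ idems hs"
    using assms by (intro vagner.sym[OF idems_absorb_set]) auto
  also have "idems ks @ idems hs \<approx> idems hs @ idems ks"
    using assms by (intro idems_commute) auto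
  also have "idems hs @ idems ks \<approx> idems ks"
    using assms by (intro idems_absorb_set) auto
  finally show ?thesis .
qed

text \<open>The hard half of Munn's theorem: up to the congruence, the normal form depends only on
  the visited set and the end vertex. Each further letter adds one idempotent and lengthens or
  shortens the final path.\<close>

lemma vagner_normal_form:
  "w \<in> LX \<Longrightarrow> w \<approx> idems (trace [] w) @ rev (walk w [])"
proof (induction w rule: rev_induct)
  case Nil
  then show ?case by (simp add: vertex_idem_def vagner.refl)
next
  case (snoc x w)
  define E where "E = idems (trace [] w)"
  define k where "k = walk w []"
  have w: "w \<in> LX" and x: "x \<in> letters X" "[x] \<in> LX" "[letter_inv x] \<in> LX"
    using snoc.prems by auto
  have tr: "set (trace [] w) \<subseteq> LX"
    using visited_lists[of "[]" "letters X" w] w by (simp add: set_trace)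
  then have E: "E \<in> LX" unfolding E_def by (rule idems_lists)
  have k: "k \<in> set (trace [] w)" by (simp add: k_def set_trace)
  then have k': "k \<in> LX" using tr by (rule rev_subsetD)
  then have rk: "rev k \<in> LX" by (simp add: in_lists_conv_set)
  have step: "w @ [x] \<approx> E @ rev k @ [x]"
    using vagner.mult[OF snoc.IH[OF w] vagner.refl[of "[x]"]] x by (simp add: E_def k_def)
  show ?case
  proof (cases "push x k = x # k")
    case True
    have "E @ rev k @ [x] \<approx> E @ (rev k @ [x]) @ word_inv (rev k @ [x]) @ rev k @ [x]"
      using E rk x by (intro vagner_left vagner.sym[OF vagner.regular]) auto
    from vagner.trans[OF step this] show ?thesis
      using True by (simp add: trace_snoc vertex_idem_def k_def[symmetric] E_def[symmetric])
  next
    case False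
    define h where "h = rev (push x k)"
    have kh: "rev k = h @ [letter_inv x]"
      using False push_cases[of x k] by (metis h_def rev.simps(2))
    have h: "h \<in> LX" "word_inv h \<in> LX"
      using rk kh word_inv_lists[of h X] by simp_all
    have "E \<approx> E @ vertex_idem k"
      using vagner.trans[OF vagner.sym[OF idems_absorb] vertex_idem_idems_commute] k k' tr
      by (simp add: E_def)
    then have "E @ h \<approx> (E @ vertex_idem k) @ h"
      using h by (intro vagner_right)
    also have "(E @ vertex_idem k) @ h = (E @ h) @ ([letter_inv x] @ word_inv [letter_inv x] @
        word_inv h @ word_inv (word_inv h)) @ []"
      by (simp add: vertex_idem_def kh)
    finally have "E @ h \<approx> (E @ h) @ ([letter_inv x] @ word_inv [letter_inv x] @
        word_inv h @ word_inv (word_inv h)) @ []" .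
    also have "((E @ h) @ ([letter_inv x] @ word_inv [letter_inv x] @
        word_inv h @ word_inv (word_inv h)) @ []) \<approx> ((E @ h) @ (word_inv h @
        word_inv (word_inv h) @ [letter_inv x] @ word_inv [letter_inv x]) @ [])"
      using E h x by (intro vagner_left vagner_right vagner.commute) auto
    finally have "E @ h \<approx> E @ (h @ word_inv h @ h) @ [letter_inv x, x]"
      by simp
    also have "E @ (h @ word_inv h @ h) @ [letter_inv x, x] \<approx> E @ h @ [letter_inv x, x]"
      using E h x by (intro vagner_left vagner_right vagner.regular) auto
    finally have *: "E @ h \<approx> E @ h @ [letter_inv x, x]" .
    have "w @ [x] \<approx> E @ h @ [letter_inv x, x]"
      using step kh by simp
    also have "E @ h @ [letter_inv x, x] \<approx> E @ h" using * by (rule vagner.sym)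
    also have "E @ h \<approx> E @ (h @ word_inv h @ h)"
      using E h by (intro vagner_left vagner.sym[OF vagner.regular])
    finally show ?thesis
      by (simp add: trace_snoc vertex_idem_def k_def[symmetric] E_def[symmetric] h_def)
  qed
qed

theorem munn:
  assumes "u \<in> LX" "v \<in> LX"
  shows "u \<approx> v \<longleftrightarrow> visited [] u = visited [] v \<and> walk u [] = walk v []"
proof
  assume "visited [] u = visited [] v \<and> walk u [] = walk v []"
  then have eq: "visited [] u = visited [] v" "walk u [] = walk v []" by auto
  have sub: "visited [] u \<subseteq> LX" using assms by (intro visited_lists) auto
  then have "walk v [] \<in> LX" by (rule subsetD) (simp add: eq)
  then have r: "rev (walk v []) \<in> LX" by (simp add: in_lists_conv_set)
  have "u \<approx> idems (trace [] u) @ rev (walk v [])"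
    using vagner_normal_form assms eq by metis
  also have "idems (trace [] u) @ rev (walk v []) \<approx> idems (trace [] v) @ rev (walk v [])"
    using sub eq r by (intro vagner_right idems_cong) (auto simp: set_trace)
  also have "idems (trace [] v) @ rev (walk v []) \<approx> v"
    using vagner_normal_form assms by (blast intro: vagner.sym)
  finally show "u \<approx> v" .
qed (use vagner_walk_visited[of u v X "[]"] in simp)

end

corollary proj_eq_iff_munn:
  assumes "u \<in> lists (letters X)" "v \<in> lists (letters X)"
  shows "proj X u = proj X v \<longleftrightarrow> visited [] u = visited [] v \<and> walk u [] = walk v []"
  using assms by (simp only: proj_eq_iff munn)

section \<open>Geodesics\<close>

fun fresh_walk :: "'a word set \<Rightarrow> 'a word \<Rightarrow> 'a word \<Rightarrow> bool" where
  "fresh_walk T h [] \<longleftrightarrow> True"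
| "fresh_walk T h (x # w) \<longleftrightarrow> (push x h = x # h \<longrightarrow> x # h \<notin> T) \<and>
     fresh_walk (insert (push x h) T) (push x h) w"

text \<open>\<open>T\<close> is a finite subtree containing the root and the current vertex \<open>h\<close>.\<close>

definition tree_state :: "'a set \<Rightarrow> 'a word set \<Rightarrow> 'a word \<Rightarrow> bool" where
  "tree_state X T h \<longleftrightarrow> finite T \<and> T \<subseteq> lists (letters X) \<and> [] \<in> T \<and> h \<in> T \<and>
     (\<forall>x t. x # t \<in> T \<longrightarrow> t \<in> T \<and> push x t = x # t)"

lemma tree_state_init: "tree_state X {[]} []"
  by (simp add: tree_state_def)

lemma tree_state_push:
  assumes "tree_state X T h" "x \<in> letters X"
  shows "tree_state X (insert (push x h) T) (push x h)"
proof -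
  have "push x h \<in> lists (letters X)"
    using assms by (intro push_lists) (auto simp: tree_state_def)
  moreover have "push x h = x # h \<or> push x h \<in> T"
  proof (cases rule: push_cases[of x h])
    case 2
    then have "letter_inv x # push x h \<in> T" using assms by (simp add: tree_state_def)
    then show ?thesis using assms by (auto simp: tree_state_def)
  qed simp
  moreover have "t \<in> insert (push x h) T \<and> push y t = y # t"
    if "y # t \<in> insert (push x h) T" for y t
  proof (cases "y # t \<in> T")
    case True
    then show ?thesis using assms(1) unfolding tree_state_def by blast
  next
    case False
    then have "push x h = y # t" "push x h = x # h" using that calculation(2) by auto
    then show ?thesis using assms(1) by (simp add: tree_state_def)
  qed
  ultimately show ?thesis
    using assms(1) unfolding tree_state_def by blast
qed

text \<open>A step away from the root into a new vertex and a step towards the root both increase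
  \<open>2 |T| - |h|\<close> by one, a step away from the root into an old vertex decreases it.\<close>

lemma length_walk:
  assumes "tree_state X T h" "w \<in> lists (letters X)"
  shows "2 * card (T \<union> visited h w) + length h \<le> length w + 2 * card T + length (walk w h) \<and>
    (2 * card (T \<union> visited h w) + length h = length w + 2 * card T + length (walk w h)
       \<longleftrightarrow> fresh_walk T h w)"
  using assms
proof (induction w arbitrary: T h)
  case Nil
  then show ?case by (auto simp: tree_state_def insert_absorb)
next
  case (Cons x w)
  let ?h = "push x h" and ?T = "insert (push x h) T"
  have st: "tree_state X ?T ?h" using Cons.prems by (auto intro: tree_state_push)
  have w: "w \<in> lists (letters X)" using Cons.prems by auto
  have fin: "finite T" and h: "h \<in> T" using Cons.prems by (auto simp: tree_state_def)
  have eq: "T \<union> visited h (x # w) = ?T \<union> visited ?h w"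
    using h by auto
  have old: "?h \<noteq> x # h \<Longrightarrow> ?h \<in> T" "?h \<noteq> x # h \<Longrightarrow> length h = Suc (length ?h)"
    using push_cases[of x h] Cons.prems unfolding tree_state_def
    by (metis, metis length_Cons)
  note IH = Cons.IH[OF st w]
  show ?case
  proof (cases "?h = x # h")
    case True
    then show ?thesis using IH fin eq
      by (cases "x # h \<in> T") (auto simp: insert_absorb)
  next
    case False
    then have "?T = T" using old by auto
    then show ?thesis using IH eq old(2)[OF False] False by simp
  qed
qed

lemma not_fresh_walkE:
  assumes "\<not> fresh_walk T h w"
  obtains p x q where "w = p @ x # q" "push x (walk p h) = x # walk p h"
    "x # walk p h \<in> T \<union> visited h p"
proof -
  have "\<exists>p x q. w = p @ x # q \<and> push x (walk p h) = x # walk p h \<and>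
    x # walk p h \<in> T \<union> visited h p"
    using assms
  proof (induction w arbitrary: T h)
    case (Cons z w)
    show ?case
    proof (cases "push z h = z # h \<and> z # h \<in> T")
      case True
      then show ?thesis by (intro exI[of _ "[]"]) auto
    next
      case False
      with Cons.prems have "\<not> fresh_walk (insert (push z h) T) (push z h) w" by auto
      from Cons.IH[OF this] obtain p x q where
        "w = p @ x # q" "push x (walk p (push z h)) = x # walk p (push z h)"
        "x # walk p (push z h) \<in> insert (push z h) T \<union> visited (push z h) p" by blast
      then show ?thesis by (intro exI[of _ "z # p"]) auto
    qed
  qed simp
  then show ?thesis using that by blast
qed

text \<open>The walk starts outside the subtree below \<open>x # k\<close>, whose only entrance is
  the edge from \<open>k\<close>.\<close>

lemma first_visit:
  assumes "x # k \<in> visited h p" "\<nexists>s. h = s @ x # k"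
  obtains p1 p2 where "p = p1 @ x # p2" "walk p1 h = k"
proof -
  have "\<exists>p1 p2. p = p1 @ x # p2 \<and> walk p1 h = k"
    using assms
  proof (induction p arbitrary: h)
    case (Cons z p)
    show ?case
    proof (cases "\<exists>s. push z h = s @ x # k")
      case True
      then obtain s where s: "push z h = s @ x # k" by blast
      have "push z h = z # h"
        using push_cases[of z h] s Cons.prems(2) by (metis append_Cons)
      with s Cons.prems(2) have "z = x \<and> h = k" by (cases s) auto
      then have "z # p = [] @ x # p \<and> walk [] h = k" by simp
      then show ?thesis by blast
    next
      case False
      have "x # k \<in> visited (push z h) p"
        using Cons.prems by (metis append_Nil insertE visited.simps(2))
      from Cons.IH[OF this False] obtain p1 p2 where "p = p1 @ x # p2" "walk p1 (push z h) = k"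
        by blast
      then have "z # p = (z # p1) @ x # p2 \<and> walk (z # p1) h = k" by simp
      then show ?thesis by blast
    qed
  qed auto
  then show ?thesis using that by blast
qed

text \<open>If the edge \<open>x\<close> at a vertex is used twice away from the root, then traversing backwards
  the loop between both uses saves two letters.\<close>

lemma shorten_not_fresh:
  assumes "w \<in> lists (letters X)" "\<not> fresh_walk {[]} [] w"
  obtains u where "u \<in> lists (letters X)" "proj X u = proj X w" "length u < length w"
proof -
  obtain p x q where w: "w = p @ x # q" and k: "push x (walk p []) = x # walk p []"
    and vis: "x # walk p [] \<in> {[]} \<union> visited [] p"
    using not_fresh_walkE[OF assms(2)] by blast
  define k where "k = walk p []"
  have "x # k \<in> visited [] p" using vis by (simp add: k_def)
  then obtain p1 p2 where p: "p = p1 @ x # p2" "walk p1 [] = k"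
    by (rule first_visit) simp
  have kx: "push x k = x # k" using k by (simp only: k_def)
  have red: "reduced (x # k)"
    using kx reduced_walk[of "[]" p] by (simp add: k_def)
  have "walk (p1 @ x # p2) [] = k" by (simp only: k_def p(1))
  then have kp: "walk p2 (x # k) = k" using p(2) kx by simp
  have loop: "walk (word_inv p2) k = x # k" "visited k (word_inv p2) = visited (x # k) p2"
    using walk_word_inv[OF red, of p2] visited_word_inv[OF red, of p2] kp by simp_all
  let ?u = "p1 @ word_inv p2 @ q"
  have u: "?u \<in> lists (letters X)"
    using assms(1) word_inv_lists[of p2 X] by (simp add: w p(1))
  have "walk ?u [] = walk w []"
    using kx loop p(2) kp by (simp add: w p(1))
  moreover have "visited [] ?u = visited [] w"
    using kx loop p(2) kp walk_in_visited[of p1 "[]"] walk_in_visited[of p2 "x # k"]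
    by (auto simp: w p(1) visited_append)
  ultimately have "proj X ?u = proj X w"
    using proj_eq_iff_munn[OF u assms(1)] by simp
  then show ?thesis using that[OF u] by (simp add: w p(1) word_inv_def)
qed

text \<open>By \<open>length_walk\<close> a fresh walk attains a lower bound,
  \<open>2 (|T| - 1) - |g|\<close>, that depends only on the element. This alone provides no word
  that beats a walk which is not fresh; \<open>shorten_not_fresh\<close> does.\<close>

lemma Geo_iff_fresh_walk:
  "w \<in> Geo X \<longleftrightarrow> w \<in> lists (letters X) \<and> fresh_walk {[]} [] w"
proof (intro iffI conjI)
  assume w: "w \<in> Geo X"
  then show wL: "w \<in> lists (letters X)" unfolding Geo_def by blast
  show "fresh_walk {[]} [] w"
  proof (rule ccontr)
    assume "\<not> fresh_walk {[]} [] w"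
    with wL obtain u where "u \<in> lists (letters X)" "proj X u = proj X w" "length u < length w"
      by (rule shorten_not_fresh)
    moreover have "\<forall>u \<in> lists (letters X). proj X u = proj X w \<longrightarrow> length w \<le> length u"
      using w unfolding Geo_def by blast
    ultimately show False by (metis not_le)
  qed
next
  assume w: "w \<in> lists (letters X) \<and> fresh_walk {[]} [] w"
  have "length w \<le> length u" if u: "u \<in> lists (letters X)" "proj X u = proj X w" for u
  proof -
    have "visited [] u = visited [] w" "walk u [] = walk w []"
      using proj_eq_iff_munn[of u X w] u w by auto
    then show ?thesis
      using length_walk[OF tree_state_init[of X], of u] length_walk[OF tree_state_init[of X], of w]
        u w by auto
  qed
  then show "w \<in> Geo X" using w unfolding Geo_def by blast
qed

section \<open>Trivial conjugacy classes\<close>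

definition adj :: "'a word set \<Rightarrow> 'a word \<Rightarrow> 'a letter set" where
  "adj T h = {x. push x h \<in> T}"

lemma adj_letters: "T \<subseteq> lists (letters X) \<Longrightarrow> h \<in> T \<Longrightarrow> adj T h \<subseteq> letters X"
proof
  fix x assume T: "T \<subseteq> lists (letters X)" "h \<in> T" "x \<in> adj T h"
  show "x \<in> letters X"
  proof (cases rule: push_cases[of x h])
    case 1
    then show ?thesis using T by (auto simp: adj_def)
  next
    case 2
    then have "letter_inv x # push x h \<in> lists (letters X)" using T by auto
    then show ?thesis by auto
  qed
qed

lemma i_conjugate_proj:
  assumes "u \<in> lists (letters X)" "w \<in> lists (letters X)" "v \<in> lists (letters X)"
  shows "inverse_of (FIM X) (proj X u) \<otimes>\<^bsub>FIM X\<^esub> proj X w \<otimes>\<^bsub>FIM X\<^esub> proj X u = proj X v \<longleftrightarrow>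
      proj X (word_inv u @ w @ u) = proj X v"
    and "proj X u \<otimes>\<^bsub>FIM X\<^esub> proj X v \<otimes>\<^bsub>FIM X\<^esub> inverse_of (FIM X) (proj X u) = proj X w \<longleftrightarrow>
      proj X (u @ v @ word_inv u) = proj X w"
  using assms word_inv_lists[of u X]
  by (simp_all add: inverse_of_proj proj_mult)

text \<open>A letter \<open>x\<close> used at the root and at the end gives the conjugate
  \<open>x^-1 w x\<close>, whose tree is rooted one edge further along \<open>x\<close>. Conversely,
  a conjugator must be readable in the tree from both vertices, so disjointness forces the empty
  word.\<close>

lemma trivial_conj_class_iff:
  assumes w: "w \<in> lists (letters X)"
  shows "conj_class (FIM X) (proj X w) = {proj X w} \<longleftrightarrow>
    adj (visited [] w) [] \<inter> adj (visited [] w) (walk w []) = {}"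
proof
  let ?T = "visited [] w"
  have T: "?T \<subseteq> lists (letters X)" using w by (intro visited_lists) auto
  assume triv: "conj_class (FIM X) (proj X w) = {proj X w}"
  show "adj ?T [] \<inter> adj ?T (walk w []) = {}"
  proof (rule ccontr)
    assume "adj ?T [] \<inter> adj ?T (walk w []) \<noteq> {}"
    then obtain x where x: "x \<in> adj ?T []" "x \<in> adj ?T (walk w [])" by blast
    then have xX: "x \<in> letters X" using adj_letters[OF T visited_self] by blast
    let ?y = "letter_inv x"
    let ?v = "[?y] @ w @ [x]"
    have v: "?v \<in> lists (letters X)" using w xX by simp
    have conj: "proj X ([x] @ ?v @ [?y]) = proj X w"
    proof (subst proj_eq_iff_munn)
      have r: "reduced (walk w [])" by (rule reduced_walk) simp
      have "walk ([x] @ ?v @ [?y]) [] = walk w []"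
        using push_inv[OF r, of x] by simp
      moreover have "visited [] ([x] @ ?v @ [?y]) = visited [] w"
        using push_inv[OF r, of x] x by (auto simp: visited_append adj_def)
      ultimately show "visited [] ([x] @ ?v @ [?y]) = visited [] w \<and>
        walk ([x] @ ?v @ [?y]) [] = walk w []" by simp
    qed (use v w xX in auto)
    have "proj X ?v \<in> conj_class (FIM X) (proj X w)"
      unfolding conj_class_def i_conjugate_def
      using conj v xX i_conjugate_proj[of "[x]" X w ?v] w
      by (auto simp: carrier_FIM intro!: bexI[of _ "proj X [x]"])
    then have eq: "(?v, w) \<in> vagner X" using triv v w by (simp add: proj_eq_iff[symmetric])
    \<comment> \<open>Iterating the assumed triviality puts the paths \<open>y^n\<close> for all
      \<open>n\<close> into the finite tree.\<close>
    have "(replicate n ?y @ w @ replicate n x, w) \<in> vagner X" for n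
    proof (induction n)
      case 0
      then show ?case using w by (simp add: vagner.refl)
    next
      case (Suc n)
      have "([?y] @ (replicate n ?y @ w @ replicate n x) @ [x], [?y] @ w @ [x]) \<in> vagner X"
        using Suc xX by (intro vagner_left vagner_right) auto
      from vagner.trans[OF this eq] show ?case
        by (simp add: replicate_append_same)
    qed
    then have "visited [] (replicate n ?y @ w @ replicate n x) = ?T" for n
      using vagner_walk_visited[of "replicate n ?y @ w @ replicate n x" w X "[]"] by simp
    moreover have "walk (replicate n ?y) [] = replicate n ?y" for n
    proof (induction n)
      case (Suc n)
      have "walk (replicate (Suc n) ?y) [] = push ?y (walk (replicate n ?y) [])"
        by (simp only: replicate_append_same[symmetric] replicate_Suc fold_append comp_apply
            fold_simps)
      then show ?case using Suc by (cases n) auto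
    qed simp
    ultimately have "replicate n ?y \<in> ?T" for n
      using walk_in_visited[of "replicate n ?y" "[]"] visited_append by (metis UnI1)
    then have "range (\<lambda>n. replicate n ?y) \<subseteq> ?T" by auto
    moreover have "inj (\<lambda>n. replicate n ?y)" by (auto intro: injI dest: arg_cong[of _ _ length])
    ultimately show False using finite_subset finite_imageD infinite_UNIV_nat finite_visited by metis
  qed
next
  let ?T = "visited [] w"
  assume disj: "adj ?T [] \<inter> adj ?T (walk w []) = {}"
  have "b = proj X w" if b: "b \<in> conj_class (FIM X) (proj X w)" for b
  proof -
    from b obtain u v where uv: "u \<in> lists (letters X)" "v \<in> lists (letters X)" "b = proj X v"
      "proj X (word_inv u @ w @ u) = proj X v" "proj X (u @ v @ word_inv u) = proj X w"
      unfolding conj_class_def i_conjugate_def carrier_FIM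
      using i_conjugate_proj[OF _ w] by (smt (verit) image_iff mem_Collect_eq)
    \<comment> \<open>Conjugating back and forth fixes \<open>w\<close>, so \<open>u\<close> can be
      read inside \<open>?T\<close> both from the root and from the end of \<open>w\<close>.\<close>
    have "(u @ (word_inv u @ w @ u) @ word_inv u, u @ v @ word_inv u) \<in> vagner X"
      using uv w by (intro vagner_left vagner_right) (simp_all add: proj_eq_iff[symmetric] ball_Un)
    moreover have "(u @ v @ word_inv u, w) \<in> vagner X"
      using uv w word_inv_lists[of u X] by (simp add: proj_eq_iff[symmetric] ball_Un)
    ultimately have *: "visited [] (u @ (word_inv u @ w @ u) @ word_inv u) = ?T"
      by (metis vagner_walk_visited reduced.simps(1))
    have "walk (word_inv u) (walk u []) = []" by (rule walk_word_inv) simp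
    with * have sub: "visited [] u \<subseteq> ?T" "visited (walk w []) u \<subseteq> ?T"
      by (auto simp: visited_append)
    have "u = []"
    proof (cases u)
      case (Cons x u')
      then have "x \<in> adj ?T [] \<inter> adj ?T (walk w [])" using sub by (auto simp: adj_def)
      then show ?thesis using disj by blast
    qed
    then show ?thesis using uv by simp
  qed
  moreover have "proj X w \<in> conj_class (FIM X) (proj X w)"
    unfolding conj_class_def i_conjugate_def
    using w i_conjugate_proj[of "[]" X w w]
    by (auto simp: carrier_FIM intro!: bexI[of _ "proj X []"])
  ultimately show "conj_class (FIM X) (proj X w) = {proj X w}" by blast
qed

section \<open>Leftmost derivations\<close>

text \<open>The sentential form acts as a stack that consumes the word from the left, so that
  derivations can be compared with walks one letter at a time.\<close>

inductive leftmost :: "('n, 't) production set \<Rightarrow> ('n, 't) symbol list \<Rightarrow> 't list \<Rightarrow> bool"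
  for P where
  Nil: "leftmost P [] []"
| Tm: "leftmost P \<alpha> w \<Longrightarrow> leftmost P (Tm a # \<alpha>) (a # w)"
| NT: "(A, \<gamma>) \<in> P \<Longrightarrow> leftmost P (\<gamma> @ \<alpha>) w \<Longrightarrow> leftmost P (NT A # \<alpha>) w"

lemma leftmost_Nil_iff [simp]: "leftmost P [] w \<longleftrightarrow> w = []"
  by (auto intro: leftmost.Nil elim: leftmost.cases)

lemma leftmost_Tm_Cons_iff [simp]:
  "leftmost P (Tm a # \<alpha>) (b # w) \<longleftrightarrow> a = b \<and> leftmost P \<alpha> w"
  by (auto intro: leftmost.Tm elim: leftmost.cases)

lemma leftmost_Tm_Nil [simp]: "\<not> leftmost P (Tm a # \<alpha>) []"
  by (auto elim: leftmost.cases)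

lemma leftmost_NT_iff:
  "leftmost P (NT A # \<alpha>) w \<longleftrightarrow> (\<exists>\<gamma>. (A, \<gamma>) \<in> P \<and> leftmost P (\<gamma> @ \<alpha>) w)"
  by (auto intro: leftmost.NT elim: leftmost.cases)

lemma leftmost_map_Tm_iff: "leftmost P (map Tm v) w \<longleftrightarrow> w = v"
proof (induction v arbitrary: w)
  case (Cons a v)
  then show ?case by (cases w) auto
qed simp

lemma derives1_prepend: "derives1 P \<alpha> \<beta> \<Longrightarrow> derives1 P (\<gamma> @ \<alpha>) (\<gamma> @ \<beta>)"
proof (induction rule: derives1.induct)
  case (1 A \<delta> \<alpha> \<beta>)
  then show ?case using derives1.intros[of A \<delta> P "\<gamma> @ \<alpha>" \<beta>] by simp
qed

lemma derives_prepend: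
  "(derives1 P)\<^sup>*\<^sup>* \<alpha> \<beta> \<Longrightarrow> (derives1 P)\<^sup>*\<^sup>* (\<gamma> @ \<alpha>) (\<gamma> @ \<beta>)"
  by (induction rule: rtranclp_induct) (auto intro: rtranclp.rtrancl_into_rtrancl derives1_prepend)

lemma leftmost_imp_derives: "leftmost P \<alpha> w \<Longrightarrow> (derives1 P)\<^sup>*\<^sup>* \<alpha> (map Tm w)"
proof (induction rule: leftmost.induct)
  case (Tm \<alpha> w a)
  then show ?case using derives_prepend[of P \<alpha> "map Tm w" "[Tm a]"] by simp
next
  case (NT A \<gamma> \<alpha> w)
  then show ?case
    using derives1.intros[of A \<gamma> P "[]" \<alpha>] by (auto intro: converse_rtranclp_into_rtranclp)
qed simp

text \<open>Undoes one production at an arbitrary position; applied backwards along a derivation it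
  yields a leftmost one.\<close>

lemma leftmost_expand:
  "leftmost P \<zeta> w \<Longrightarrow> \<zeta> = \<alpha> @ \<gamma> @ \<beta> \<Longrightarrow> (A, \<gamma>) \<in> P \<Longrightarrow> leftmost P (\<alpha> @ NT A # \<beta>) w"
proof (induction arbitrary: \<alpha> rule: leftmost.induct)
  case Nil
  then show ?case by (auto simp: leftmost_NT_iff)
next
  case (Tm \<zeta> w a)
  show ?case
  proof (cases \<alpha>)
    case Nil
    then have "leftmost P (\<gamma> @ \<beta>) (a # w)"
      using leftmost.Tm[OF Tm.hyps, of a] Tm.prems(1) by (metis append_Nil)
    then show ?thesis using Tm.prems Nil by (auto intro: leftmost.NT)
  next
    case (Cons s \<alpha>')
    then show ?thesis using Tm by (auto intro: leftmost.Tm)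
  qed
next
  case (NT B \<delta> \<zeta> w)
  show ?case
  proof (cases \<alpha>)
    case Nil
    then have "leftmost P (\<gamma> @ \<beta>) w" using NT.hyps NT.prems by (metis append_Nil leftmost.NT)
    then show ?thesis using NT.prems Nil by (auto intro: leftmost.NT)
  next
    case (Cons s \<alpha>')
    then show ?thesis using NT.hyps NT.prems NT.IH[of "\<delta> @ \<alpha>'"]
      by (auto intro: leftmost.NT)
  qed
qed

lemma derives_imp_leftmost: "(derives1 P)\<^sup>*\<^sup>* \<alpha> (map Tm w) \<Longrightarrow> leftmost P \<alpha> w"
proof (induction rule: converse_rtranclp_induct)
  case base
  then show ?case by (simp add: leftmost_map_Tm_iff)
next
  case (step \<alpha> \<beta>)
  from step.hyps(1) show ?case
    by (cases rule: derives1.cases) (auto intro: leftmost_expand[OF step.IH])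
qed

lemma generated_iff_leftmost: "w \<in> generated P S \<longleftrightarrow> leftmost P [NT S] w"
  unfolding generated_def using leftmost_imp_derives derives_imp_leftmost by auto

abbreviation rename_prods ::
  "('n \<Rightarrow> 'm) \<Rightarrow> ('n, 't) production set \<Rightarrow> ('m, 't) production set" where
  "rename_prods f P \<equiv> map_prod f (map (map_symbol f id)) ` P"

lemma leftmost_rename:
  "leftmost P \<alpha> w \<Longrightarrow> leftmost (rename_prods f P) (map (map_symbol f id) \<alpha>) w"
proof (induction rule: leftmost.induct)
  case (NT A \<gamma> \<alpha> w)
  from imageI[OF NT.hyps(1), of "map_prod f (map (map_symbol f id))"]
  have "(f A, map (map_symbol f id) \<gamma>) \<in> rename_prods f P" by simp
  from leftmost.NT[OF this] show ?case using NT.IH by (simp only: map_append list.map symbol.map)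
qed (auto intro: leftmost.Tm)

lemma leftmost_lists:
  assumes "P \<subseteq> N \<times> lists (NT ` N \<union> Tm ` \<Sigma>)"
  shows "leftmost P \<alpha> w \<Longrightarrow> \<alpha> \<in> lists (NT ` N \<union> Tm ` \<Sigma>) \<Longrightarrow> w \<in> lists \<Sigma>"
proof (induction rule: leftmost.induct)
  case (NT A \<gamma> \<alpha> w)
  moreover from NT.hyps(1) have "\<gamma> \<in> lists (NT ` N \<union> Tm ` \<Sigma>)" using assms by blast
  ultimately show ?case by (simp add: ball_Un)
qed auto

lemma symbol_image_iff [simp]:
  "NT A \<in> NT ` N \<longleftrightarrow> A \<in> N" "Tm a \<in> Tm ` \<Sigma> \<longleftrightarrow> a \<in> \<Sigma>" "NT A \<notin> Tm ` \<Sigma>" "Tm a \<notin> NT ` N"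
  by auto

text \<open>Nonterminals have to be natural numbers in \<open>context_free\<close>. Renaming along
  any map preserves derivations, and renaming back by \<open>d\<close>, a left inverse of
  \<open>e\<close> on \<open>N\<close>, restores \<open>P\<close>; this gives both
  inclusions.\<close>

lemma context_freeI:
  fixes N :: "'n set"
  assumes "finite \<Sigma>" "finite N" "finite P" "S \<in> N" "P \<subseteq> N \<times> lists (NT ` N \<union> Tm ` \<Sigma>)"
    and L: "\<And>w. w \<in> L \<longleftrightarrow> leftmost P [NT S] w"
  shows "context_free \<Sigma> L"
proof -
  obtain e :: "'n \<Rightarrow> nat" where e: "inj_on e N"
    using finite_imp_inj_to_nat_seg[OF \<open>finite N\<close>] by blast
  define d where "d = inv_into N e"
  have de: "d (e A) = A" if "A \<in> N" for A
    using e that by (simp add: d_def)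
  let ?P = "rename_prods e P"
  have sym: "map (map_symbol d id) (map (map_symbol e id) \<gamma>) = \<gamma>"
    if "\<gamma> \<in> lists (NT ` N \<union> Tm ` \<Sigma>)" for \<gamma> :: "('n, 'a) symbol list"
    using that by (induction \<gamma>) (auto simp: de)
  have inverse: "rename_prods d ?P = P"
  proof -
    have "map_prod d (map (map_symbol d id)) (map_prod e (map (map_symbol e id)) p) = p"
      if "p \<in> P" for p
    proof (cases p)
      case (Pair A \<gamma>)
      then have "A \<in> N" "\<gamma> \<in> lists (NT ` N \<union> Tm ` \<Sigma>)" using that assms(5) by blast+
      then show ?thesis using de sym Pair by (simp del: map_map)
    qed
    then show ?thesis by (simp add: image_image)
  qed
  have "leftmost ?P [NT (e S)] w \<longleftrightarrow> leftmost P [NT S] w" for w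
  proof
    assume "leftmost ?P [NT (e S)] w"
    from leftmost_rename[OF this, of d] show "leftmost P [NT S] w"
      using \<open>S \<in> N\<close> by (simp only: inverse) (simp add: de)
  next
    assume "leftmost P [NT S] w"
    from leftmost_rename[OF this, of e] show "leftmost ?P [NT (e S)] w" by simp
  qed
  then have "L = generated ?P (e S)"
    using L by (auto simp: generated_iff_leftmost)
  moreover have "?P \<subseteq> e ` N \<times> lists (NT ` e ` N \<union> Tm ` \<Sigma>)"
  proof
    fix p assume "p \<in> ?P"
    then obtain A \<gamma> where p: "p = (e A, map (map_symbol e id) \<gamma>)" "(A, \<gamma>) \<in> P" by auto
    then have "A \<in> N" "set \<gamma> \<subseteq> NT ` N \<union> Tm ` \<Sigma>" using assms(5) by auto
    then show "p \<in> e ` N \<times> lists (NT ` e ` N \<union> Tm ` \<Sigma>)"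
      using p by (fastforce simp: image_iff)
  qed
  ultimately show ?thesis
    using assms unfolding context_free_def
    by (intro conjI exI[of _ "e ` N"] exI[of _ ?P] exI[of _ "e S"]) auto
qed

section \<open>A grammar for the geodesics with trivial conjugacy class\<close>

text \<open>The set \<open>F\<close> contains the edges at the current vertex that have been used, together
  with the one to its parent. \<open>Tour F\<close> generates the remaining closed tours below the vertex,
  \<open>Down F B\<close> the remaining walks that end weakly below the vertex, where \<open>B\<close> is the final set
  of edges at the root; \<open>Root F\<close> generates the remaining walks from the root.
  The words in \<open>V\<close> are added to the language of \<open>Root {}\<close>.\<close>

datatype 'a variable =
  Start | Tour "'a letter set" | Down "'a letter set" "'a letter set" | Root "'a letter set"

abbreviation detour ::
  "'a letter \<Rightarrow> 'a variable \<Rightarrow> ('a variable, 'a letter) symbol list" where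
  "detour x A \<equiv> [Tm x, NT (Tour {letter_inv x}), Tm (letter_inv x), NT A]"

text \<open>The condition \<open>x \<in> L - F\<close> enforces freshness and, since
  \<open>F\<close> holds the parent edge, leaves only the closing terminal of a detour as a way
  back. \<open>Down_Nil\<close> is the triviality test. At the root it would compare
  \<open>F\<close> with itself, so \<open>Root_Nil\<close> demands \<open>F = {}\<close>. In
  \<open>Root_step\<close> the departing edge, too, counts as used at the root.\<close>

inductive_set prods ::
  "'a letter set \<Rightarrow> 'a word set \<Rightarrow> ('a variable, 'a letter) production set" for L V where
  Tour_Nil: "F \<subseteq> L \<Longrightarrow> (Tour F, []) \<in> prods L V"
| Tour: "F \<subseteq> L \<Longrightarrow> x \<in> L - F \<Longrightarrow> (Tour F, detour x (Tour (insert x F))) \<in> prods L V"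
| Down_Nil: "F \<subseteq> L \<Longrightarrow> B \<subseteq> L \<Longrightarrow> F \<inter> B = {} \<Longrightarrow> (Down F B, []) \<in> prods L V"
| Down: "F \<subseteq> L \<Longrightarrow> B \<subseteq> L \<Longrightarrow> x \<in> L - F \<Longrightarrow>
    (Down F B, detour x (Down (insert x F) B)) \<in> prods L V"
| Down_step: "F \<subseteq> L \<Longrightarrow> B \<subseteq> L \<Longrightarrow> x \<in> L - F \<Longrightarrow>
    (Down F B, [Tm x, NT (Down {letter_inv x} B)]) \<in> prods L V"
| Root_Nil: "(Root {}, []) \<in> prods L V"
| Root: "F \<subseteq> L \<Longrightarrow> x \<in> L - F \<Longrightarrow> (Root F, detour x (Root (insert x F))) \<in> prods L V"
| Root_step: "F \<subseteq> L \<Longrightarrow> x \<in> L - F \<Longrightarrow>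
    (Root F, [Tm x, NT (Down {letter_inv x} (insert x F))]) \<in> prods L V"
| Start_Root: "(Start, [NT (Root {})]) \<in> prods L V"
| Start: "v \<in> V \<Longrightarrow> (Start, map Tm v) \<in> prods L V"

definition nonterminals :: "'a letter set \<Rightarrow> 'a variable set" where
  "nonterminals L = insert Start
     (Tour ` Pow L \<union> Root ` Pow L \<union> (\<lambda>(F, B). Down F B) ` (Pow L \<times> Pow L))"

lemma in_nonterminals [simp]:
  "Start \<in> nonterminals L" "Tour F \<in> nonterminals L \<longleftrightarrow> F \<subseteq> L"
  "Root F \<in> nonterminals L \<longleftrightarrow> F \<subseteq> L" "Down F B \<in> nonterminals L \<longleftrightarrow> F \<subseteq> L \<and> B \<subseteq> L"
  by (auto simp: nonterminals_def)

lemma finite_nonterminals: "finite L \<Longrightarrow> finite (nonterminals L)"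
  by (simp add: nonterminals_def)

lemma prods_iff:
  "(Tour F, \<gamma>) \<in> prods L V \<longleftrightarrow>
    F \<subseteq> L \<and> (\<gamma> = [] \<or> (\<exists>x \<in> L - F. \<gamma> = detour x (Tour (insert x F))))"
  "(Down F B, \<gamma>) \<in> prods L V \<longleftrightarrow> F \<subseteq> L \<and> B \<subseteq> L \<and> (F \<inter> B = {} \<and> \<gamma> = [] \<or>
    (\<exists>x \<in> L - F. \<gamma> = detour x (Down (insert x F) B) \<or> \<gamma> = [Tm x, NT (Down {letter_inv x} B)]))"
  "(Root F, \<gamma>) \<in> prods L V \<longleftrightarrow> F = {} \<and> \<gamma> = [] \<or> F \<subseteq> L \<and> (\<exists>x \<in> L - F.
    \<gamma> = detour x (Root (insert x F)) \<or> \<gamma> = [Tm x, NT (Down {letter_inv x} (insert x F))])"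
  "(Start, \<gamma>) \<in> prods L V \<longleftrightarrow> \<gamma> = [NT (Root {})] \<or> (\<exists>v \<in> V. \<gamma> = map Tm v)"
  by (subst prods.simps; auto)+

lemma prods_subset:
  assumes L: "\<And>x. x \<in> L \<Longrightarrow> letter_inv x \<in> L" and V: "V \<subseteq> lists L"
  shows "prods L V \<subseteq> nonterminals L \<times> lists (NT ` nonterminals L \<union> Tm ` L)"
proof
  fix p assume p: "p \<in> prods L V"
  show "p \<in> nonterminals L \<times> lists (NT ` nonterminals L \<union> Tm ` L)"
  proof (cases p)
    case (Pair A \<gamma>)
    moreover have "x \<in> L" if "v \<in> V" "x \<in> set v" for v x
      using V that by auto
    ultimately show ?thesis
      using p by (cases A) (auto simp: prods_iff L lists_eq_set)
  qed
qed

lemma finite_prods: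
  assumes L: "\<And>x. x \<in> L \<Longrightarrow> letter_inv x \<in> L" and V: "V \<subseteq> lists L" and "finite L" "finite V"
  shows "finite (prods L V)"
proof (rule finite_subset)
  let ?\<Gamma> = "NT ` nonterminals L \<union> Tm ` L"
  let ?W = "{\<gamma>. set \<gamma> \<subseteq> ?\<Gamma> \<and> length \<gamma> \<le> 4}"
  show "prods L V \<subseteq> nonterminals L \<times> ?W \<union> (\<lambda>v. (Start, map Tm v)) ` V"
  proof
    fix p assume p: "p \<in> prods L V"
    then have "p \<in> nonterminals L \<times> lists ?\<Gamma>"
      using prods_subset[OF L V] by blast
    then have "fst p \<in> nonterminals L" "set (snd p) \<subseteq> ?\<Gamma>"
      by (cases p, force simp: lists_eq_set)+
    moreover have "length (snd p) \<le> 4 \<or> p \<in> (\<lambda>v. (Start, map Tm v)) ` V"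
    proof (cases p)
      case (Pair A \<gamma>)
      with p show ?thesis by (cases A) (auto simp: prods_iff)
    qed
    ultimately show "p \<in> nonterminals L \<times> ?W \<union> (\<lambda>v. (Start, map Tm v)) ` V"
      by (cases p) auto
  qed
  show "finite (nonterminals L \<times> ?W \<union> (\<lambda>v. (Start, map Tm v)) ` V)"
    using assms by (intro finite_UnI finite_cartesian_product finite_lists_length_le)
      (auto simp: finite_nonterminals)
qed

lemma leftmost_Nil_iffs:
  "F \<subseteq> L \<Longrightarrow> leftmost (prods L V) (NT (Tour F) # \<alpha>) [] \<longleftrightarrow> leftmost (prods L V) \<alpha> []"
  "F \<subseteq> L \<Longrightarrow> B \<subseteq> L \<Longrightarrow> leftmost (prods L V) (NT (Down F B) # \<alpha>) [] \<longleftrightarrow>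
    F \<inter> B = {} \<and> leftmost (prods L V) \<alpha> []"
  "leftmost (prods L V) (NT (Root F) # \<alpha>) [] \<longleftrightarrow> F = {} \<and> leftmost (prods L V) \<alpha> []"
  by (subst leftmost_NT_iff; auto simp: prods_iff)+

text \<open>Here \<open>tl\<close> drops the terminal \<open>x\<close> that has just been matched. A
  tour may end before \<open>x\<close> and leave it to \<open>\<alpha>\<close>, whereas
  \<open>Down\<close> and \<open>Root\<close> are unfolded as last symbols, where ending would leave
  \<open>x\<close> unread.\<close>

lemma leftmost_Tour_Cons: "F \<subseteq> L \<Longrightarrow>
  leftmost (prods L V) (NT (Tour F) # \<alpha>) (x # w) \<longleftrightarrow> leftmost (prods L V) \<alpha> (x # w) \<or>
    x \<in> L - F \<and> leftmost (prods L V) (tl (detour x (Tour (insert x F))) @ \<alpha>) w"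
  by (subst leftmost_NT_iff) (auto simp: prods_iff)

lemma leftmost_Down_Cons: "F \<subseteq> L \<Longrightarrow> B \<subseteq> L \<Longrightarrow>
  leftmost (prods L V) [NT (Down F B)] (x # w) \<longleftrightarrow> x \<in> L - F \<and>
    (leftmost (prods L V) (tl (detour x (Down (insert x F) B))) w \<or>
     leftmost (prods L V) [NT (Down {letter_inv x} B)] w)"
  by (subst leftmost_NT_iff) (auto simp: prods_iff)

lemma leftmost_Root_Cons: "F \<subseteq> L \<Longrightarrow>
  leftmost (prods L V) [NT (Root F)] (x # w) \<longleftrightarrow> x \<in> L - F \<and>
    (leftmost (prods L V) (tl (detour x (Root (insert x F)))) w \<or>
     leftmost (prods L V) [NT (Down {letter_inv x} (insert x F))] w)"
  by (subst leftmost_NT_iff) (auto simp: prods_iff)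

lemma leftmost_Start: "leftmost (prods L V) [NT Start] w \<longleftrightarrow>
    w \<in> V \<or> leftmost (prods L V) [NT (Root {})] w"
  by (subst leftmost_NT_iff) (auto simp: prods_iff leftmost_map_Tm_iff)

text \<open>Merges freshness and the final triviality test into one recursion along the word, the
  shape in which the grammar reads it.\<close>

fun accepts :: "'a word set \<Rightarrow> 'a word \<Rightarrow> 'a word \<Rightarrow> bool" where
  "accepts T h [] \<longleftrightarrow> adj T [] \<inter> adj T h = {}"
| "accepts T h (x # w) \<longleftrightarrow> (push x h = x # h \<longrightarrow> x # h \<notin> T) \<and>
     accepts (insert (push x h) T) (push x h) w"

lemma accepts_iff:
  "h \<in> T \<Longrightarrow> accepts T h w \<longleftrightarrow> fresh_walk T h w \<and>
    adj (T \<union> visited h w) [] \<inter> adj (T \<union> visited h w) (walk w h) = {}"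
proof (induction w arbitrary: T h)
  case (Cons x w)
  have "T \<union> visited h (x # w) = insert (push x h) T \<union> visited (push x h) w"
    using Cons.prems by auto
  then show ?case using Cons.IH[of "push x h" "insert (push x h) T"] by simp
qed (simp add: insert_absorb)

text \<open>The sentential forms that may generate the rest of a walk which has visited \<open>T\<close> and is
  at \<open>h\<close>: they differ in the ancestor of \<open>h\<close> below which the walk ends.\<close>

fun forms :: "'a word set \<Rightarrow> 'a word \<Rightarrow> ('a variable, 'a letter) symbol list set" where
  "forms T [] = {[NT (Root (adj T []))]}"
| "forms T (y # h) = insert [NT (Down (adj T (y # h)) (adj T []))]
     ((\<lambda>f. NT (Tour (adj T (y # h))) # Tm (letter_inv y) # f) ` forms T h)"

lemma length_push: "length (push x h) \<le> Suc (length h)"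
  by (cases h) auto

lemma adj_insert_shorter:
  assumes "length k < length h"
  shows "adj (insert (x # h) T) k = adj T k"
proof -
  have "push z k \<noteq> x # h" for z
    using assms length_push[of z k] by auto
  then show ?thesis by (auto simp: adj_def)
qed

text \<open>The edge sets stored for proper ancestors of \<open>h\<close> stay valid when the walk
  steps below \<open>h\<close>: their neighbours are too short to be \<open>x # h\<close>.\<close>

lemma forms_insert_shorter: "length k < length h \<Longrightarrow> forms (insert (x # h) T) k = forms T k"
proof (induction k)
  case (Cons y k)
  moreover have "adj (insert (x # h) T) [] = adj T []"
    using Cons.prems by (intro adj_insert_shorter) (cases h; simp)
  ultimately show ?case by (simp add: adj_insert_shorter)
qed (simp add: adj_insert_shorter)

lemma adj_insert_self:
  assumes x: "push x h = x # h"
  shows "adj (insert (x # h) T) h = insert x (adj T h)"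
proof -
  have "push z h = x # h \<longleftrightarrow> z = x" for z
  proof (cases rule: push_cases[of z h])
    case 2
    then have "length h = Suc (length (push z h))" by (metis length_Cons)
    then have "push z h \<noteq> x # h" by auto
    then show ?thesis using x by blast
  qed simp
  then show ?thesis by (auto simp: adj_def)
qed

text \<open>As \<open>T\<close> is closed under parents, it contains nothing beyond a missing
  vertex. Hence the set \<open>{letter_inv x}\<close> with which the grammar starts at a new
  vertex.\<close>

lemma adj_insert_child:
  assumes "tree_state X T h" "x # h \<notin> T"
  shows "adj (insert (x # h) T) (x # h) = {letter_inv x}"
proof -
  have "z # x # h \<notin> T" "h \<in> T" for z
    using assms unfolding tree_state_def by blast+
  then show ?thesis by (auto simp: adj_def letter_inv_eq_iff)
qed

text \<open>After a letter into a new vertex, what remains of the forms at \<open>h\<close> are the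
  forms at \<open>x # h\<close>: a detour leaves one that returns to \<open>h\<close>, a step the
  \<open>Down\<close> form of the new vertex.\<close>

lemma accepts_iff_leftmost:
  assumes "tree_state X T h" "w \<in> lists (letters X)"
  shows "accepts T h w \<longleftrightarrow> (\<exists>f \<in> forms T h. leftmost (prods (letters X) V) f w)"
  using assms
proof (induction w arbitrary: T h)
  case Nil
  have "adj T [] \<subseteq> letters X" "adj T h \<subseteq> letters X"
    using Nil.prems by (auto simp: tree_state_def intro!: adj_letters del: subsetI)
  then show ?case by (cases h) (auto simp: leftmost_Nil_iffs)
next
  case (Cons x w)
  have x: "x \<in> letters X" and w: "w \<in> lists (letters X)" using Cons.prems by auto
  have sub: "adj T [] \<subseteq> letters X" "adj T h \<subseteq> letters X"
    using Cons.prems by (auto simp: tree_state_def intro!: adj_letters del: subsetI)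
  let ?T = "insert (push x h) T"
  have IH: "accepts ?T (push x h) w \<longleftrightarrow>
      (\<exists>f \<in> forms ?T (push x h). leftmost (prods (letters X) V) f w)"
    using Cons.IH tree_state_push[OF Cons.prems(1) x] w by blast
  have h: "h \<in> T" and tl: "\<And>y t. y # t \<in> T \<Longrightarrow> t \<in> T"
    using Cons.prems by (auto simp: tree_state_def)
  consider (pop) t where "h = letter_inv x # t"
    | (old) "push x h = x # h" "x # h \<in> T" | (new) "push x h = x # h" "x # h \<notin> T"
    using push_cases[of x h] by metis
  then show ?case
  proof cases
    \<comment> \<open>The letter is the parent edge, so no production of the nonterminals at
      \<open>h\<close> reads it; only a tour that ends at \<open>h\<close> can match it, by its
      closing terminal.\<close>
    case pop
    then have t: "push x h = t" "t \<in> T" using h tl by auto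
    then have "x \<in> adj T h" by (simp add: adj_def)
    then show ?thesis
      using IH t pop sub by (auto simp: insert_absorb leftmost_Down_Cons leftmost_Tour_Cons)
  next
    case old
    then have "x \<in> adj T h" by (simp add: adj_def)
    then show ?thesis using old sub
      by (cases h) (auto simp: leftmost_Down_Cons leftmost_Tour_Cons leftmost_Root_Cons)
  next
    case new
    then have notin: "x \<notin> adj T h" by (simp add: adj_def)
    note adj = adj_insert_self[OF new(1), of T] adj_insert_child[OF Cons.prems(1) new(2)]
    show ?thesis
    proof (cases h)
      case Nil
      then show ?thesis using IH new adj sub x notin by (simp add: leftmost_Root_Cons disj_commute)
    next
      case (Cons y t)
      have "adj (insert (x # h) T) [] = adj T []" "forms (insert (x # h) T) t = forms T t"
          using Cons by (simp_all add: adj_insert_shorter forms_insert_shorter)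
      \<comment> \<open>Otherwise a tour could end at \<open>h\<close> and match \<open>x\<close>
        with its closing terminal \<open>letter_inv y\<close>.\<close>
      moreover have "y \<noteq> letter_inv x" using new(1) Cons by (auto split: if_splits)
      ultimately show ?thesis
        using IH new adj sub x notin Cons
        by (auto simp: leftmost_Down_Cons leftmost_Tour_Cons)
    qed
  qed
qed

theorem theorem4p6:
  fixes X :: "'a set"
  assumes "finite X"
  shows "context_free (letters X) (UConjGeo X)"
proof -
  let ?triv = "\<lambda>w. conj_class (FIM X) (proj X w) = {proj X w}"
  define V where "V = {w \<in> UConjGeo X. \<not> ?triv w}"
  have fin: "finite (letters X)" using assms by (simp add: letters_def)
  have lists: "w \<in> lists (letters X)" if "w \<in> UConjGeo X" for w
    using that unfolding UConjGeo_def Geo_def by blast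
  then have V: "V \<subseteq> lists (letters X)" by (auto simp: V_def)
  have carr: "proj X w \<in> carrier (FIM X)" if "w \<in> Geo X" for w
    using that unfolding carrier_FIM Geo_def by blast
  have "length v \<le> length w" if "v \<in> V" "w \<in> V" for v w
    using that carr by (auto simp: V_def UConjGeo_def UConj_def)
  then have "\<exists>n. \<forall>v \<in> V. length v \<le> n" by blast
  then have "\<exists>n. V \<subseteq> {w. set w \<subseteq> letters X \<and> length w \<le> n}"
    using V unfolding lists_eq_set by blast
  then have "finite V" using finite_lists_length_le[OF fin] by (metis finite_subset)
  have "w \<in> UConjGeo X \<longleftrightarrow> leftmost (prods (letters X) V) [NT Start] w" for w
  proof -
    \<comment> \<open>An element with trivial class is related by \<open>UConj\<close> only to
      itself, so being geodesic is enough for its words.\<close>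
    have "w \<in> UConjGeo X \<longleftrightarrow> w \<in> V \<or> w \<in> Geo X \<and> ?triv w"
      unfolding V_def UConjGeo_def UConj_def Geo_def by auto
    also have "w \<in> Geo X \<and> ?triv w \<longleftrightarrow> w \<in> lists (letters X) \<and> accepts {[]} [] w"
      using trivial_conj_class_iff[of w X] accepts_iff[of "[]" "{[]}" w]
      by (auto simp: Geo_iff_fresh_walk insert_absorb)
    also have "\<dots> \<longleftrightarrow> w \<in> lists (letters X) \<and> leftmost (prods (letters X) V) [NT (Root {})] w"
      using accepts_iff_leftmost[OF tree_state_init, of w X V] by (auto simp: adj_def)
    also have "\<dots> \<longleftrightarrow> leftmost (prods (letters X) V) [NT (Root {})] w"
      using leftmost_lists[OF prods_subset, of "letters X" V "[NT (Root {})]" w] V by auto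
    finally show ?thesis by (simp add: leftmost_Start)
  qed
  then show ?thesis
    using fin \<open>finite V\<close> V
    by (intro context_freeI[where N = "nonterminals (letters X)" and P = "prods (letters X) V"
          and S = Start] prods_subset finite_prods finite_nonterminals) auto
qed

end
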